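(* The relation $\mathtt{Sat}_{\Delta_0}\subseteq\mathbb{N}^2$ is not definable by any $\Delta_0$-formula; that is, there is no $\Delta_0$-formula $\varsigma(x,y)$ such that $\mathtt{Sat}_{\Delta_0}=\{(p,q)\in\mathbb{N}^2 \mid \mathbb{N}\models\varsigma(p,q)\}$.
   Context: $\mathbb{N}$ contains $0$ and also denotes the standard model of arithmetic. Formulas are first-order formulas in the language $\langle 0,1,+,\times,\leqslant\rangle$ with equality and variables $v_0,v_1,v_2,\ldots$. Bounded formulas. A formula is bounded (a $\Delta_0$-formula) if it is constructed from atomic formulas $t=s$, $t\leqslant s$ ($t,s$ terms) by means of negation, conjunction, disjunction, implication and bounded quantifications $\forall x\leqslant t$, $\exists x\leqslant t$, where $t$ is a term in which the variable $x$ does not occur; $\forall x\leqslant t\,\mathcal{A}$ abbreviates $\forall x[x\leqslant t\rightarrow\mathcal{A}]$ and $\exists x\leqslant t\,\mathcal{A}$ abbreviates $\exists x[x\leqslant t\wedge\mathcal{A}]$. Gödel coding. Fix a Gödel coding $\alpha\mapsto\ulcorner\alpha\urcorner\in\mathbb{N}$ of terms and formulas which is primitive recursive in the usual sense: it is injective; the set of codes of variables is primitive recursive and the passages from $i$ to $\ulcorner v_i\urcorner$ and back are primitive recursive; the codes of $t+s$, $t\times s$, $t=s$, $t\leqslant s$, $\neg A$, $A\wedge B$, $A\vee B$, $A\rightarrow B$, $\forall x\leqslant t\,A$, $\exists x\leqslant t\,A$ are given by primitive recursive functions of the codes of the constituents (terms $t,s$, formulas $A,B$, variable $x$), and are strictly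 greater than the codes of these constituents. Satisfaction. $\mathtt{Sat}_{\Delta_0}$ is the set of all ordered pairs $(\ulcorner\theta(\vec\nu)\urcorner,a)$ where $\theta(\vec\nu)$ is a $\Delta_0$-formula with free variables $\vec\nu$, $a\in\mathbb{N}$, and $\mathbb{N}\models\theta(\vec a)$, i.e. the sentence resulting from substituting (the numeral of) the single number $a$ for every free variable of $\theta$ is true in $\mathbb{N}$. *)

theory Defs
  imports Main
begin

datatype tm = Zero | One | Var nat | Add tm tm | Mul tm tm

datatype fm =
    Eq tm tm
  | Le tm tm
  | Neg fm
  | And fm fm
  | Or fm fm
  | Imp fm fm
  | All nat fm
  | Ex nat fm

abbreviation BAll :: "nat \<Rightarrow> tm \<Rightarrow> fm \<Rightarrow> fm" where
  "BAll x t A \<equiv> All x (Imp (Le (Var x) t) A)"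

abbreviation BEx :: "nat \<Rightarrow> tm \<Rightarrow> fm \<Rightarrow> fm" where
  "BEx x t A \<equiv> Ex x (And (Le (Var x) t) A)"

fun vars_tm :: "tm \<Rightarrow> nat set" where
  "vars_tm Zero = {}"
| "vars_tm One = {}"
| "vars_tm (Var i) = {i}"
| "vars_tm (Add t s) = vars_tm t \<union> vars_tm s"
| "vars_tm (Mul t s) = vars_tm t \<union> vars_tm s"

fun fv :: "fm \<Rightarrow> nat set" where
  "fv (Eq t s) = vars_tm t \<union> vars_tm s"
| "fv (Le t s) = vars_tm t \<union> vars_tm s"
| "fv (Neg A) = fv A"
| "fv (And A B) = fv A \<union> fv B"
| "fv (Or A B) = fv A \<union> fv B"
| "fv (Imp A B) = fv A \<union> fv B"
| "fv (All x A) = fv A - {x}"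
| "fv (Ex x A) = fv A - {x}"

inductive delta0 :: "fm \<Rightarrow> bool" where
  "delta0 (Eq t s)"
| "delta0 (Le t s)"
| "delta0 A \<Longrightarrow> delta0 (Neg A)"
| "delta0 A \<Longrightarrow> delta0 B \<Longrightarrow> delta0 (And A B)"
| "delta0 A \<Longrightarrow> delta0 B \<Longrightarrow> delta0 (Or A B)"
| "delta0 A \<Longrightarrow> delta0 B \<Longrightarrow> delta0 (Imp A B)"
| "x \<notin> vars_tm t \<Longrightarrow> delta0 A \<Longrightarrow> delta0 (BAll x t A)"
| "x \<notin> vars_tm t \<Longrightarrow> delta0 A \<Longrightarrow> delta0 (BEx x t A)"

fun val :: "(nat \<Rightarrow> nat) \<Rightarrow> tm \<Rightarrow> nat" where
  "val e Zero = 0"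
| "val e One = 1"
| "val e (Var i) = e i"
| "val e (Add t s) = val e t + val e s"
| "val e (Mul t s) = val e t * val e s"

fun holds :: "(nat \<Rightarrow> nat) \<Rightarrow> fm \<Rightarrow> bool" where
  "holds e (Eq t s) \<longleftrightarrow> val e t = val e s"
| "holds e (Le t s) \<longleftrightarrow> val e t \<le> val e s"
| "holds e (Neg A) \<longleftrightarrow> \<not> holds e A"
| "holds e (And A B) \<longleftrightarrow> holds e A \<and> holds e B"
| "holds e (Or A B) \<longleftrightarrow> holds e A \<or> holds e B"
| "holds e (Imp A B) \<longleftrightarrow> (holds e A \<longrightarrow> holds e B)"
| "holds e (All x A) \<longleftrightarrow> (\<forall>n. holds (e(x := n)) A)"
| "holds e (Ex x A) \<longleftrightarrow> (\<exists>n. holds (e(x := n)) A)"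

(* Used below only for sentences, where the choice of e is immaterial. *)
definition true_in_N :: "fm \<Rightarrow> bool" where
  "true_in_N A \<longleftrightarrow> (\<forall>e. holds e A)"

fun num :: "nat \<Rightarrow> tm" where
  "num 0 = Zero"
| "num (Suc n) = Add (num n) One"

fun subst_tm :: "(nat \<Rightarrow> tm) \<Rightarrow> tm \<Rightarrow> tm" where
  "subst_tm \<sigma> Zero = Zero"
| "subst_tm \<sigma> One = One"
| "subst_tm \<sigma> (Var i) = \<sigma> i"
| "subst_tm \<sigma> (Add t s) = Add (subst_tm \<sigma> t) (subst_tm \<sigma> s)"
| "subst_tm \<sigma> (Mul t s) = Mul (subst_tm \<sigma> t) (subst_tm \<sigma> s)"

(* Simultaneous substitution for the free occurrences of variables. Bound variables are
   not renamed: no capture can occur as long as each \<sigma> i is a closed term or Var i,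
   which is the case in all uses below. *)
fun subst :: "(nat \<Rightarrow> tm) \<Rightarrow> fm \<Rightarrow> fm" where
  "subst \<sigma> (Eq t s) = Eq (subst_tm \<sigma> t) (subst_tm \<sigma> s)"
| "subst \<sigma> (Le t s) = Le (subst_tm \<sigma> t) (subst_tm \<sigma> s)"
| "subst \<sigma> (Neg A) = Neg (subst \<sigma> A)"
| "subst \<sigma> (And A B) = And (subst \<sigma> A) (subst \<sigma> B)"
| "subst \<sigma> (Or A B) = Or (subst \<sigma> A) (subst \<sigma> B)"
| "subst \<sigma> (Imp A B) = Imp (subst \<sigma> A) (subst \<sigma> B)"
| "subst \<sigma> (All x A) = All x (subst (\<sigma>(x := Var x)) A)"
| "subst \<sigma> (Ex x A) = Ex x (subst (\<sigma>(x := Var x)) A)"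

(* prim_rec n F: F, restricted to argument lists of length n, is a primitive recursive
   n-ary function. The values of F on lists of any other length are irrelevant. *)
inductive prim_rec :: "nat \<Rightarrow> (nat list \<Rightarrow> nat) \<Rightarrow> bool" where
  zero: "prim_rec n (\<lambda>xs. 0)"
| succ: "prim_rec 1 (\<lambda>xs. Suc (xs ! 0))"
| proj: "i < n \<Longrightarrow> prim_rec n (\<lambda>xs. xs ! i)"
| comp: "prim_rec (length Gs) F \<Longrightarrow> \<forall>G \<in> set Gs. prim_rec n G \<Longrightarrow>
    prim_rec n (\<lambda>xs. F (map (\<lambda>G. G xs) Gs))"
| recursion: "prim_rec n F \<Longrightarrow> prim_rec (n + 2) G \<Longrightarrow>
    prim_rec (Suc n)
      (\<lambda>xs. rec_nat (F (tl xs)) (\<lambda>k r. G (k # r # tl xs)) (hd xs))"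

(* A coding of terms (Inl) and formulas (Inr) by natural numbers, jointly injective.
   The bounded quantifiers are considered only where they are formed, i.e. with x not
   occurring in t, and the variable x enters through the code of the term Var x. *)
locale goedel_coding =
  fixes code :: "tm + fm \<Rightarrow> nat"
  assumes inj: "inj code"
    and var_set: "\<exists>F. prim_rec 1 F \<and>
      (\<forall>n. F [n] = (if n \<in> range (\<lambda>i. code (Inl (Var i))) then 1 else 0))"
    and var_to: "\<exists>F. prim_rec 1 F \<and> (\<forall>i. code (Inl (Var i)) = F [i])"
    and var_from: "\<exists>F. prim_rec 1 F \<and> (\<forall>i. i = F [code (Inl (Var i))])"
    and Add: "\<exists>F. prim_rec 2 F \<and>
      (\<forall>t s. code (Inl (Add t s)) = F [code (Inl t), code (Inl s)])"
    and Mul: "\<exists>F. prim_rec 2 F \<and>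
      (\<forall>t s. code (Inl (Mul t s)) = F [code (Inl t), code (Inl s)])"
    and Eq: "\<exists>F. prim_rec 2 F \<and>
      (\<forall>t s. code (Inr (Eq t s)) = F [code (Inl t), code (Inl s)])"
    and Le: "\<exists>F. prim_rec 2 F \<and>
      (\<forall>t s. code (Inr (Le t s)) = F [code (Inl t), code (Inl s)])"
    and Neg: "\<exists>F. prim_rec 1 F \<and>
      (\<forall>A. code (Inr (Neg A)) = F [code (Inr A)])"
    and And: "\<exists>F. prim_rec 2 F \<and>
      (\<forall>A B. code (Inr (And A B)) = F [code (Inr A), code (Inr B)])"
    and Or: "\<exists>F. prim_rec 2 F \<and>
      (\<forall>A B. code (Inr (Or A B)) = F [code (Inr A), code (Inr B)])"
    and Imp: "\<exists>F. prim_rec 2 F \<and>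
      (\<forall>A B. code (Inr (Imp A B)) = F [code (Inr A), code (Inr B)])"
    and BAll: "\<exists>F. prim_rec 3 F \<and>
      (\<forall>x t A. x \<notin> vars_tm t \<longrightarrow>
        code (Inr (BAll x t A)) = F [code (Inl (Var x)), code (Inl t), code (Inr A)])"
    and BEx: "\<exists>F. prim_rec 3 F \<and>
      (\<forall>x t A. x \<notin> vars_tm t \<longrightarrow>
        code (Inr (BEx x t A)) = F [code (Inl (Var x)), code (Inl t), code (Inr A)])"
    and Add_gt: "code (Inl t) < code (Inl (Add t s))" "code (Inl s) < code (Inl (Add t s))"
    and Mul_gt: "code (Inl t) < code (Inl (Mul t s))" "code (Inl s) < code (Inl (Mul t s))"
    and Eq_gt: "code (Inl t) < code (Inr (Eq t s))" "code (Inl s) < code (Inr (Eq t s))"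
    and Le_gt: "code (Inl t) < code (Inr (Le t s))" "code (Inl s) < code (Inr (Le t s))"
    and Neg_gt: "code (Inr A) < code (Inr (Neg A))"
    and And_gt: "code (Inr A) < code (Inr (And A B))" "code (Inr B) < code (Inr (And A B))"
    and Or_gt: "code (Inr A) < code (Inr (Or A B))" "code (Inr B) < code (Inr (Or A B))"
    and Imp_gt: "code (Inr A) < code (Inr (Imp A B))" "code (Inr B) < code (Inr (Imp A B))"
    and BAll_gt: "x \<notin> vars_tm t \<Longrightarrow> code (Inl (Var x)) < code (Inr (BAll x t A))"
      "x \<notin> vars_tm t \<Longrightarrow> code (Inl t) < code (Inr (BAll x t A))"
      "x \<notin> vars_tm t \<Longrightarrow> code (Inr A) < code (Inr (BAll x t A))"
    and BEx_gt: "x \<notin> vars_tm t \<Longrightarrow> code (Inl (Var x)) < code (Inr (BEx x t A))"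
      "x \<notin> vars_tm t \<Longrightarrow> code (Inl t) < code (Inr (BEx x t A))"
      "x \<notin> vars_tm t \<Longrightarrow> code (Inr A) < code (Inr (BEx x t A))"

(* The single number a is substituted for all free variables of \<theta>. *)
definition Sat_delta0 :: "(tm + fm \<Rightarrow> nat) \<Rightarrow> (nat \<times> nat) set" where
  "Sat_delta0 code =
    {(code (Inr \<theta>), a) | \<theta> a. delta0 \<theta> \<and> true_in_N (subst (\<lambda>i. num a) \<theta>)}"

end

(* Sat puts one number in place of all free variables, so the diagonal substitution is already
   built into it and no fixed-point lemma is needed: if sigma defines Sat and p is the code of
   "not sigma", then (p, p) is in Sat iff "not sigma(p, p)" is true iff (p, p) is not in Sat. *)
theory Submission imports Defs begin

lemma subst_tm_cong: "(\<And>i. i \<in> vars_tm t \<Longrightarrow> \<sigma> i = \<tau> i) \<Longrightarrow> subst_tm \<sigma> t = subst_tm \<tau> t"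
  by (induction t) auto

text \<open>Needed to exchange the substitution of one numeral for every variable with one that
  changes only two variables. Under a quantifier both substitutions are reset to
  \<open>Var x\<close>, so they still agree there.\<close>

lemma subst_cong: "(\<And>i. i \<in> fv A \<Longrightarrow> \<sigma> i = \<tau> i) \<Longrightarrow> subst \<sigma> A = subst \<tau> A"
proof (induction A arbitrary: \<sigma> \<tau>)
  case (All x A)
  have "subst (\<sigma>(x := Var x)) A = subst (\<tau>(x := Var x)) A"
    using All.prems by (intro All.IH) auto
  then show ?case by simp
next
  case (Ex x A)
  have "subst (\<sigma>(x := Var x)) A = subst (\<tau>(x := Var x)) A"
    using Ex.prems by (intro Ex.IH) auto
  then show ?case by simp
next
  case (Eq t s)
  then show ?case by (auto intro: subst_tm_cong)
next
  case (Le t s)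
  then show ?case by (auto intro: subst_tm_cong)
next
  case (And A B)
  from And.IH[of \<sigma> \<tau>] And.prems show ?case by simp
next
  case (Or A B)
  from Or.IH[of \<sigma> \<tau>] Or.prems show ?case by simp
next
  case (Imp A B)
  from Imp.IH[of \<sigma> \<tau>] Imp.prems show ?case by simp
next
  case (Neg A)
  from Neg.IH[of \<sigma> \<tau>] Neg.prems show ?case by simp
qed

lemma val_cong: "(\<And>i. i \<in> vars_tm t \<Longrightarrow> e i = e' i) \<Longrightarrow> val e t = val e' t"
  by (induction t) auto

text \<open>For a sentence the premise is vacuous, so its truth does not depend on the
  environment.\<close>

lemma holds_cong: "(\<And>i. i \<in> fv A \<Longrightarrow> e i = e' i) \<Longrightarrow> holds e A \<longleftrightarrow> holds e' A"
proof (induction A arbitrary: e e')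
  case (All x A)
  have "holds (e(x := n)) A \<longleftrightarrow> holds (e'(x := n)) A" for n
    using All.prems by (intro All.IH) auto
  then show ?case by simp
next
  case (Ex x A)
  have "holds (e(x := n)) A \<longleftrightarrow> holds (e'(x := n)) A" for n
    using Ex.prems by (intro Ex.IH) auto
  then show ?case by simp
next
  case (Eq t s)
  then show ?case using val_cong[of t e e'] val_cong[of s e e'] by simp
next
  case (Le t s)
  then show ?case using val_cong[of t e e'] val_cong[of s e e'] by simp
next
  case (And A B)
  from And.IH[of e e'] And.prems show ?case by simp
next
  case (Or A B)
  from Or.IH[of e e'] Or.prems show ?case by simp
next
  case (Imp A B)
  from Imp.IH[of e e'] Imp.prems show ?case by simp
next
  case (Neg A)
  from Neg.IH[of e e'] Neg.prems show ?case by simp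
qed

lemma vars_subst_tm: "vars_tm (subst_tm \<sigma> t) = (\<Union>i\<in>vars_tm t. vars_tm (\<sigma> i))"
  by (induction t) auto

text \<open>Serves to show that numeral instances are sentences. Equality can fail, since a
  quantifier may capture a variable of \<open>\<sigma> i\<close>.\<close>

lemma fv_subst: "fv (subst \<sigma> A) \<subseteq> (\<Union>i\<in>fv A. vars_tm (\<sigma> i))"
proof (induction A arbitrary: \<sigma>)
  case (All x A)
  have "fv (subst (\<sigma>(x := Var x)) A) - {x} \<subseteq> (\<Union>i\<in>fv A. vars_tm ((\<sigma>(x := Var x)) i)) - {x}"
    using All.IH by blast
  \<comment> \<open>The index \<open>x\<close> contributes only \<open>x\<close> itself, which is
    removed; at other indices the update changes nothing.\<close>
  also have "\<dots> \<subseteq> (\<Union>i\<in>fv A - {x}. vars_tm (\<sigma> i))"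
    by (auto split: if_splits)
  finally show ?case by simp
next
  case (Ex x A)
  have "fv (subst (\<sigma>(x := Var x)) A) - {x} \<subseteq> (\<Union>i\<in>fv A. vars_tm ((\<sigma>(x := Var x)) i)) - {x}"
    using Ex.IH by blast
  also have "\<dots> \<subseteq> (\<Union>i\<in>fv A - {x}. vars_tm (\<sigma> i))"
    by (auto split: if_splits)
  finally show ?case by simp
next
  case (And A B)
  from And.IH[of \<sigma>] show ?case by (simp add: UN_Un le_supI1 le_supI2)
next
  case (Or A B)
  from Or.IH[of \<sigma>] show ?case by (simp add: UN_Un le_supI1 le_supI2)
next
  case (Imp A B)
  from Imp.IH[of \<sigma>] show ?case by (simp add: UN_Un le_supI1 le_supI2)
next
  case (Neg A)
  from Neg.IH[of \<sigma>] show ?case by simp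
qed (simp_all add: vars_subst_tm UN_Un)

lemma vars_num: "vars_tm (num n) = {}"
  by (induction n) auto

text \<open>\<open>true_in_N\<close> quantifies over all environments, so it commutes with negation
  only when they all agree on \<open>A\<close>, as they do for a sentence.\<close>

lemma true_in_N_Neg:
  assumes "fv A = {}"
  shows "true_in_N (Neg A) \<longleftrightarrow> \<not> true_in_N A"
  using holds_cong[of A] assms by (auto simp: true_in_N_def)

theorem theorem2p2:
  fixes code :: "tm + fm \<Rightarrow> nat"
  assumes "goedel_coding code"
  shows "\<not> (\<exists>\<sigma> x y. delta0 \<sigma> \<and> x \<noteq> y \<and> fv \<sigma> \<subseteq> {x, y} \<and>
    Sat_delta0 code = {(p, q). true_in_N (subst (Var(x := num p, y := num q)) \<sigma>)})"
proof
  assume "\<exists>\<sigma> x y. delta0 \<sigma> \<and> x \<noteq> y \<and> fv \<sigma> \<subseteq> {x, y} \<and>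
    Sat_delta0 code = {(p, q). true_in_N (subst (Var(x := num p, y := num q)) \<sigma>)}"
  then obtain \<sigma> x y where \<sigma>: "delta0 \<sigma>" "fv \<sigma> \<subseteq> {x, y}"
    and Sat: "Sat_delta0 code = {(p, q). true_in_N (subst (Var(x := num p, y := num q)) \<sigma>)}"
    by blast
  define p where "p = code (Inr (Neg \<sigma>))"
  have inj: "inj code"
    using assms by (rule goedel_coding.inj)
  \<comment> \<open>By injectivity \<open>Neg \<sigma>\<close> is the only formula with code
    \<open>p\<close>, and it is again bounded.\<close>
  have "(p, p) \<in> Sat_delta0 code \<longleftrightarrow> true_in_N (subst (\<lambda>i. num p) (Neg \<sigma>))"
    using \<sigma>(1) by (auto simp: Sat_delta0_def p_def inj_eq[OF inj] intro: delta0.intros)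
  \<comment> \<open>Numerals are closed, so the instance of \<open>\<sigma>\<close> is a sentence
    and the negation can be pulled out.\<close>
  also have "\<dots> \<longleftrightarrow> \<not> true_in_N (subst (\<lambda>i. num p) \<sigma>)"
    using fv_subst[of "\<lambda>i. num p" \<sigma>] by (simp add: true_in_N_Neg vars_num)
  \<comment> \<open>Both substitutions send \<open>x\<close> and \<open>y\<close> to
    \<open>num p\<close>, and \<open>\<sigma>\<close> has no other free variables.\<close>
  also have "subst (\<lambda>i. num p) \<sigma> = subst (Var(x := num p, y := num p)) \<sigma>"
    using \<sigma>(2) by (intro subst_cong) auto
  finally show False
    by (simp add: Sat)
qed

end
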